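(* Let $k\in(0,1)$, let $S$ be a $t$-conorm, let $T_M(x,y)=\min(x,y)$ and $S_M(x,y)=\max(x,y)$ on $[0,1]$, and let $F_M$ be the nullnorm with absorbing element $k$ given by $$F_M(x,y)=\begin{cases} k\,S\!\left(\frac{x}{k},\frac{y}{k}\right), & (x,y)\in[0,k]^2,\\[2pt] k+(1-k)\,T_M\!\left(\frac{x-k}{1-k},\frac{y-k}{1-k}\right), & (x,y)\in(k,1]^2,\\[2pt] k, & \text{otherwise.}\end{cases}$$ A fuzzy subset $\sigma:[0,1]\to[0,1]$ is an $F_M$-fuzzy $t$-subconorm of $([0,1],S_M)$ if and only if $\sigma(0)=1$ and $\sigma(x)\ge k$ for every $x\in[0,1]$.
   Context: A $t$-conorm is a commutative, associative, coordinatewise non-decreasing operation on $[0,1]$ with identity $0$. A nullnorm with absorbing element $k$ is a commutative, associative, coordinatewise non-decreasing map $F:[0,1]^2\to[0,1]$ with $F(k,x)=k$ for all $x$, $F(0,x)=x$ for $x\le k$, and $F(1,x)=x$ for $x\ge k$. An $F_M$-fuzzy $t$-subconorm of $([0,1],S_M)$ is a map $\sigma:[0,1]\to[0,1]$ with $F_M(\sigma(x),\sigma(y))\le\sigma(S_M(x,y))$ for all $x,y\in[0,1]$ and $\sigma(0)=1$. *)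

theory Defs
  imports Complex_Main "HOL-Library.FuncSet"
begin

text \<open>
  The unit interval is the carrier \<^term>\<open>{0..1::real}\<close>. Operations on it and fuzzy subsets of it are
  functions on \<^typ>\<open>real\<close> of which only the restriction to the carrier matters.
\<close>

definition closed_op :: "(real \<Rightarrow> real \<Rightarrow> real) \<Rightarrow> bool" where
  "closed_op f \<longleftrightarrow> (\<forall>x\<in>{0..1}. \<forall>y\<in>{0..1}. f x y \<in> {0..1})"

definition commutative_op :: "(real \<Rightarrow> real \<Rightarrow> real) \<Rightarrow> bool" where
  "commutative_op f \<longleftrightarrow> (\<forall>x\<in>{0..1}. \<forall>y\<in>{0..1}. f x y = f y x)"

definition associative_op :: "(real \<Rightarrow> real \<Rightarrow> real) \<Rightarrow> bool" where
  "associative_op f \<longleftrightarrow>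
     (\<forall>x\<in>{0..1}. \<forall>y\<in>{0..1}. \<forall>z\<in>{0..1}. f (f x y) z = f x (f y z))"

definition nondecreasing_op :: "(real \<Rightarrow> real \<Rightarrow> real) \<Rightarrow> bool" where
  "nondecreasing_op f \<longleftrightarrow>
     (\<forall>x\<in>{0..1}. \<forall>x'\<in>{0..1}. \<forall>y\<in>{0..1}.
        x \<le> x' \<longrightarrow> f x y \<le> f x' y \<and> f y x \<le> f y x')"

definition t_conorm :: "(real \<Rightarrow> real \<Rightarrow> real) \<Rightarrow> bool" where
  "t_conorm S \<longleftrightarrow>
     closed_op S \<and> commutative_op S \<and> associative_op S \<and> nondecreasing_op S \<and>
     (\<forall>x\<in>{0..1}. S x 0 = x)"

definition nullnorm :: "real \<Rightarrow> (real \<Rightarrow> real \<Rightarrow> real) \<Rightarrow> bool" where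
  "nullnorm k F \<longleftrightarrow>
     k \<in> {0..1} \<and>
     closed_op F \<and> commutative_op F \<and> associative_op F \<and> nondecreasing_op F \<and>
     (\<forall>x\<in>{0..1}. F k x = k) \<and>
     (\<forall>x\<in>{0..k}. F 0 x = x) \<and>
     (\<forall>x\<in>{k..1}. F 1 x = x)"

definition T_M :: "real \<Rightarrow> real \<Rightarrow> real" where
  "T_M x y = min x y"

definition S_M :: "real \<Rightarrow> real \<Rightarrow> real" where
  "S_M x y = max x y"

definition F_M :: "real \<Rightarrow> (real \<Rightarrow> real \<Rightarrow> real) \<Rightarrow> real \<Rightarrow> real \<Rightarrow> real" where
  "F_M k S x y =
     (if x \<in> {0..k} \<and> y \<in> {0..k} then k * S (x / k) (y / k)
      else if x \<in> {k<..1} \<and> y \<in> {k<..1}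
        then k + (1 - k) * T_M ((x - k) / (1 - k)) ((y - k) / (1 - k))
      else k)"

definition fuzzy_subset :: "(real \<Rightarrow> real) \<Rightarrow> bool" where
  "fuzzy_subset \<sigma> \<longleftrightarrow> \<sigma> \<in> {0..1} \<rightarrow> {0..1}"

definition fuzzy_t_subconorm ::
  "(real \<Rightarrow> real \<Rightarrow> real) \<Rightarrow> (real \<Rightarrow> real \<Rightarrow> real) \<Rightarrow> (real \<Rightarrow> real) \<Rightarrow> bool" where
  "fuzzy_t_subconorm F S \<sigma> \<longleftrightarrow>
     fuzzy_subset \<sigma> \<and>
     (\<forall>x\<in>{0..1}. \<forall>y\<in>{0..1}. F (\<sigma> x) (\<sigma> y) \<le> \<sigma> (S x y)) \<and>
     \<sigma> 0 = 1"

lemma F_M_low: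
  assumes "x \<in> {0..k}" "y \<in> {0..k}"
  shows "F_M k S x y = k * S (x / k) (y / k)"
  using assms by (simp add: F_M_def)

lemma F_M_high:
  assumes "k < 1" "x \<in> {k<..1}" "y \<in> {k<..1}"
  shows "F_M k S x y = min x y"
proof -
  have "min ((x - k) / (1 - k)) ((y - k) / (1 - k)) = (min x y - k) / (1 - k)"
    using assms by (simp add: min_def divide_le_cancel)
  then show ?thesis using assms by (simp add: F_M_def T_M_def)
qed

lemma F_M_mixed:
  assumes "x \<in> {0..k} \<and> y \<in> {k<..1} \<or> x \<in> {k<..1} \<and> y \<in> {0..k}"
  shows "F_M k S x y = k"
  using assms by (auto simp: F_M_def)

lemma nullnorm_F_M:
  assumes k: "k \<in> {0<..<1}" and S: "t_conorm S"
  shows "nullnorm k (F_M k S)"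
proof -
  have k0: "0 < k" "k < 1" using k by auto
  have cl: "\<And>x y. x \<in> {0..1} \<Longrightarrow> y \<in> {0..1} \<Longrightarrow> S x y \<in> {0..1}"
    and co: "\<And>x y. x \<in> {0..1} \<Longrightarrow> y \<in> {0..1} \<Longrightarrow> S x y = S y x"
    and as: "\<And>x y z. x \<in> {0..1} \<Longrightarrow> y \<in> {0..1} \<Longrightarrow> z \<in> {0..1} \<Longrightarrow> S (S x y) z = S x (S y z)"
    and mo: "\<And>x x' y. x \<in> {0..1} \<Longrightarrow> x' \<in> {0..1} \<Longrightarrow> y \<in> {0..1} \<Longrightarrow> x \<le> x' \<Longrightarrow> S x y \<le> S x' y"
    and ne: "\<And>x. x \<in> {0..1} \<Longrightarrow> S x 0 = x"
    using S unfolding t_conorm_def closed_op_def commutative_op_def associative_op_def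
      nondecreasing_op_def by blast+
  have sc: "x / k \<in> {0..1}" if "x \<in> {0..k}" for x using that k0 by auto
  have S1: "S 1 x = 1" if "x \<in> {0..1}" for x
    using mo[of 0 x 1] cl[of 1 x] co[of 1 x] co[of 0 1] ne[of 1] that by auto
  have split: "x \<in> {0..k} \<or> x \<in> {k<..1}" if "x \<in> {0..1}" for x using that by auto
  have lowcl: "F_M k S x y \<in> {0..k}" if "x \<in> {0..k}" "y \<in> {0..k}" for x y
    using F_M_low[OF that, of S] cl[OF sc[OF that(1)] sc[OF that(2)]] k0
    by (auto simp: mult_le_cancel_left2)
  have highcl: "F_M k S x y \<in> {k<..1}" if "x \<in> {k<..1}" "y \<in> {k<..1}" for x y
    using F_M_high[OF k0(2) that] that by auto
  have abs: "F_M k S k x = k" if "x \<in> {0..1}" for x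
    using split[OF that] F_M_low[of k k x S] S1[OF sc[of x]] F_M_mixed[of k k x S] k0 by auto
  have com: "F_M k S x y = F_M k S y x" if xy: "x \<in> {0..1}" "y \<in> {0..1}" for x y
  proof -
    consider "x \<in> {0..k}" "y \<in> {0..k}" | "x \<in> {k<..1}" "y \<in> {k<..1}"
      | "x \<in> {0..k} \<and> y \<in> {k<..1} \<or> x \<in> {k<..1} \<and> y \<in> {0..k}"
      using split[OF xy(1)] split[OF xy(2)] by blast
    then show ?thesis
    proof cases
      case 1
      then show ?thesis using F_M_low[OF 1] F_M_low[OF 1(2,1)] co[OF sc[OF 1(1)] sc[OF 1(2)]] by simp
    next
      case 2
      then show ?thesis
        using F_M_high[OF k0(2) 2, of S] F_M_high[OF k0(2) 2(2,1), of S] by (simp add: min.commute)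
    next
      case 3
      then have "y \<in> {0..k} \<and> x \<in> {k<..1} \<or> y \<in> {k<..1} \<and> x \<in> {0..k}" by blast
      with 3 show ?thesis by (simp only: F_M_mixed)
    qed
  qed
  have abs': "F_M k S x k = k" if "x \<in> {0..1}" for x
    using abs[OF that] com[of x k] that k0 by auto
  have sub: "x \<in> {0..1}" if "x \<in> {0..k} \<or> x \<in> {k<..1}" for x using that k0 by auto
  have closed: "F_M k S x y \<in> {0..1}" if "x \<in> {0..1}" "y \<in> {0..1}" for x y
  proof -
    have "F_M k S x y \<in> {0..k} \<or> F_M k S x y \<in> {k<..1}"
      using split[OF that(1)] split[OF that(2)] lowcl highcl F_M_mixed[of x k y S] k0 by auto
    then show ?thesis by (rule sub)
  qed
  have assoc: "F_M k S (F_M k S x y) z = F_M k S x (F_M k S y z)"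
    if xyz: "x \<in> {0..1}" "y \<in> {0..1}" "z \<in> {0..1}" for x y z
  proof -
    consider "x \<in> {0..k}" "y \<in> {0..k}" "z \<in> {0..k}" | "x \<in> {k<..1}" "y \<in> {k<..1}" "z \<in> {k<..1}"
      | "x \<in> {0..k}" "y \<in> {0..k}" "z \<in> {k<..1}" | "x \<in> {0..k}" "y \<in> {k<..1}" "z \<in> {0..k}"
      | "x \<in> {0..k}" "y \<in> {k<..1}" "z \<in> {k<..1}" | "x \<in> {k<..1}" "y \<in> {0..k}" "z \<in> {0..k}"
      | "x \<in> {k<..1}" "y \<in> {0..k}" "z \<in> {k<..1}" | "x \<in> {k<..1}" "y \<in> {k<..1}" "z \<in> {0..k}"
      using split[OF xyz(1)] split[OF xyz(2)] split[OF xyz(3)] by blast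
    then show ?thesis
    proof cases
      case 1
      show ?thesis
        using F_M_low[OF lowcl[OF 1(1,2)] 1(3), of S] F_M_low[OF 1(1) lowcl[OF 1(2,3)], of S]
          F_M_low[OF 1(1,2), of S] F_M_low[OF 1(2,3), of S] as[OF sc sc sc, OF 1] k0 by simp
    next
      case 2
      show ?thesis
        using F_M_high[OF k0(2) highcl[OF 2(1,2)] 2(3), of S]
          F_M_high[OF k0(2) 2(1) highcl[OF 2(2,3)], of S]
          F_M_high[OF k0(2) 2(1,2), of S] F_M_high[OF k0(2) 2(2,3), of S] by (simp add: min.assoc)
    qed (use abs abs' xyz lowcl highcl in \<open>simp_all add: F_M_mixed del: atLeastAtMost_iff greaterThanAtMost_iff\<close>)
  qed
  have mono1: "F_M k S x y \<le> F_M k S x' y"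
    if h: "x \<in> {0..1}" "x' \<in> {0..1}" "y \<in> {0..1}" "x \<le> x'" for x x' y
  proof (cases "y \<in> {0..k}")
    case y: True
    show ?thesis
    proof (cases "x' \<in> {0..k}")
      case True
      then have x: "x \<in> {0..k}" using h by auto
      have "S (x / k) (y / k) \<le> S (x' / k) (y / k)"
        by (rule mo[OF sc[OF x] sc[OF True] sc[OF y]]) (use h k0 in \<open>simp add: divide_right_mono\<close>)
      then show ?thesis using F_M_low[OF x y] F_M_low[OF True y] k0 by simp
    next
      case False
      then have "F_M k S x' y = k" using y split[OF h(2)] F_M_mixed by blast
      moreover have "F_M k S x y \<le> k"
        using split[OF h(1)] lowcl[of x y] F_M_mixed[of x k y S] y by auto
      ultimately show ?thesis by simp
    qed
  next
    case False
    then have y: "y \<in> {k<..1}" using split[OF h(3)] by blast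
    show ?thesis
    proof (cases "x \<in> {0..k}")
      case True
      then have "F_M k S x y = k" using y F_M_mixed by blast
      moreover have "k \<le> F_M k S x' y"
        using split[OF h(2)] highcl[of x' y] F_M_mixed[of x' k y S] y by auto
      ultimately show ?thesis by simp
    next
      case False
      then have x: "x \<in> {k<..1}" "x' \<in> {k<..1}" using h by auto
      show ?thesis using F_M_high[OF k0(2) x(1) y] F_M_high[OF k0(2) x(2) y] h(4) by simp
    qed
  qed
  have zero: "F_M k S 0 x = x" if "x \<in> {0..k}" for x
    using F_M_low[of 0 k x S] that ne[OF sc[OF that]] co[of 0 "x / k"] sc[OF that] k0 by simp
  have one: "F_M k S 1 x = x" if "x \<in> {k..1}" for x
    using F_M_high[OF k0(2), of 1 x S] abs'[of 1] that k0 by (cases "x = k") auto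
  have mono2: "F_M k S y x \<le> F_M k S y x'"
    if h: "x \<in> {0..1}" "x' \<in> {0..1}" "y \<in> {0..1}" "x \<le> x'" for x x' y
    using mono1[OF h] com[OF h(1,3)] com[OF h(2,3)] by simp
  have k01: "k \<in> {0..1}" using k0 by simp
  show ?thesis
    unfolding nullnorm_def closed_op_def commutative_op_def associative_op_def nondecreasing_op_def
    by (intro conjI ballI impI)
      ((rule k01 | rule closed com assoc mono1 mono2 abs zero one; assumption)+)
qed

end

theory Submission imports Defs begin

text \<open>Necessity comes from testing the inequality at \<open>y = 0\<close>, the identity of
  \<open>S_M\<close>, where \<open>\<sigma>\<close> equals 1: a value of \<open>\<sigma>\<close>
  below \<open>k\<close> paired with 1 lands in the mixed region, where \<open>F_M\<close> is
  constantly \<open>k\<close>. For sufficiency, values that are at least \<open>k\<close> stay in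
  the square [k,1]^2, where \<open>F_M\<close> is just the minimum (\<open>F_M_upper\<close>), and a
  minimum of two values is below each of them.\<close>

lemma F_M_upper:
  assumes k: "k \<in> {0<..<1}" and S: "t_conorm S"
    and a: "a \<in> {k..1}" and b: "b \<in> {k..1}"
  shows "F_M k S a b = min a b"
proof -
  have N: "nullnorm k (F_M k S)"
    using nullnorm_F_M[OF k S] .
  have absorbing: "F_M k S k x = k" if "x \<in> {0..1}" for x
    using N that unfolding nullnorm_def by blast
  have com: "F_M k S x y = F_M k S y x" if "x \<in> {0..1}" "y \<in> {0..1}" for x y
    using N that unfolding nullnorm_def commutative_op_def by blast
  \<comment> \<open>\<open>F_M_high\<close> covers only the half-open square; on the edges the
    absorbing element gives \<open>k\<close>, which is the minimum there.\<close>
  consider "a = k" | "b = k" | "a \<in> {k<..1}" "b \<in> {k<..1}"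
    using a b by fastforce
  then show ?thesis
  proof cases
    case 1
    then show ?thesis using absorbing[of b] k b by simp
  next
    case 2
    then show ?thesis using absorbing[of a] com[of a k] k a by simp
  next
    case 3
    then show ?thesis using F_M_high k by simp
  qed
qed

theorem proposition3p13:
  fixes k :: real and S :: "real \<Rightarrow> real \<Rightarrow> real" and \<sigma> :: "real \<Rightarrow> real"
  assumes "k \<in> {0<..<1}"
    and "t_conorm S"
    and "fuzzy_subset \<sigma>"
  shows "fuzzy_t_subconorm (F_M k S) S_M \<sigma> \<longleftrightarrow> \<sigma> 0 = 1 \<and> (\<forall>x\<in>{0..1}. \<sigma> x \<ge> k)"
proof
  have range: "\<sigma> x \<in> {0..1}" if "x \<in> {0..1}" for x
    using assms(3) that unfolding fuzzy_subset_def by blast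
  {
    assume L: "fuzzy_t_subconorm (F_M k S) S_M \<sigma>"
    then have \<sigma>0: "\<sigma> 0 = 1" unfolding fuzzy_t_subconorm_def by blast
    have "k \<le> \<sigma> x" if x: "x \<in> {0..1}" for x
    proof (rule ccontr)
      assume "\<not> k \<le> \<sigma> x"
      \<comment> \<open>The arguments lie on opposite sides of \<open>k\<close>:
        \<open>\<sigma> x < k < 1 = \<sigma> 0\<close>. As \<open>S_M x 0 = x\<close>, the
        inequality then forces \<open>k \<le> \<sigma> x\<close>.\<close>
      then have "F_M k S (\<sigma> x) (\<sigma> 0) = k"
        using range[OF x] \<sigma>0 assms(1) by (intro F_M_mixed) auto
      moreover have "F_M k S (\<sigma> x) (\<sigma> 0) \<le> \<sigma> (S_M x 0)"
        using L x unfolding fuzzy_t_subconorm_def by (meson atLeastAtMost_iff order_refl zero_le_one)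
      ultimately show False
        using \<open>\<not> k \<le> \<sigma> x\<close> x by (simp add: S_M_def)
    qed
    with \<sigma>0 show "\<sigma> 0 = 1 \<and> (\<forall>x\<in>{0..1}. \<sigma> x \<ge> k)" by blast
  next
    assume R: "\<sigma> 0 = 1 \<and> (\<forall>x\<in>{0..1}. \<sigma> x \<ge> k)"
    have "F_M k S (\<sigma> x) (\<sigma> y) \<le> \<sigma> (S_M x y)" if "x \<in> {0..1}" "y \<in> {0..1}" for x y
    proof -
      have "F_M k S (\<sigma> x) (\<sigma> y) = min (\<sigma> x) (\<sigma> y)"
        using R range that by (intro F_M_upper assms) auto
      \<comment> \<open>On a chain \<open>max x y\<close> is \<open>x\<close> or \<open>y\<close>,
        so the right side is itself \<open>\<sigma> x\<close> or \<open>\<sigma> y\<close>.\<close>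
      then show ?thesis by (simp add: S_M_def max_def)
    qed
    with R assms(3) show "fuzzy_t_subconorm (F_M k S) S_M \<sigma>"
      unfolding fuzzy_t_subconorm_def by blast
  }
qed

end
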